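(* Suppose $L$ is the Cayley table of an Abelian group of order $n$. (1) Then $L$ has a $1$-weight or a maximal near $1$-weight but not both. (2) If $\theta:L\to\mathbb{Z}$ is a function whose row and column sums are all $1$, then it cannot happen that $n-2$ symbol sums of $\theta$ are $0$ while the remaining sums are $n-i$ and $i$ with $\gcd(n,i)=1$. In particular, if $n$ is prime, then it cannot happen that precisely $n-2$ symbol sums of $\theta$ are $0$.
   Context: The Cayley table of an Abelian group $(G,+)$ of order $n$ is the latin square $L=\{(x,y,x+y): x,y\in G\}$; a triple $(x,y,z)\in L$ is the cell in row $x$ and column $y$, containing symbol $z$. For $\theta:L\to\mathbb{Z}$, the row (respectively column, symbol) sum of $\theta$ at $g\in G$ is the sum of $\theta$ over all triples of $L$ whose first (respectively second, third) coordinate is $g$. For $k\in\mathbb{Z}$, $\theta$ is a $k$-weight of $L$ if all of its row, column and symbol sums equal $k$. It is a partial $k$-weight of length $t$ if precisely $t$ row sums, $t$ column sums and $t$ symbol sums are $k$, with each remaining sum being $0$. A near $k$-weight is a partial $k$-weight of length $n-1$. A partial $k$-weight $\theta$ is maximal if, as a vector in $\mathbb{Z}^{n^2}$ (indexed by the cells of $L$), it is not dominated by another partial $k$-weight, i.e. there is no partial $k$-weight $\theta'\ne\theta$ (of any length) with $\theta\le\theta'$ in every coordinate.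
   Formalization: In the "in particular" clause (n prime) the formal statement also requires that some symbol sum is not divisible by n; without this it is false: θ = 2 on cells with symbol a, −1 on cells with symbol b, 0 elsewhere has symbol sums 2n, −n and n−2 zeros. *)

theory Defs
  imports "HOL-Algebra.Group" "HOL-Algebra.Coset" "HOL-Computational_Algebra.Primes"
begin

text \<open>The group \<open>(G, +)\<close> is a multiplicatively written \<^locale>\<open>comm_group\<close>. A function
  \<open>\<theta> : L \<rightarrow> \<int>\<close> is an HOL function on all triples; only its values on \<open>L\<close> are ever used.\<close>

definition cayley_table :: "('a, 'b) monoid_scheme \<Rightarrow> ('a \<times> 'a \<times> 'a) set" where
  "cayley_table G = {(x, y, x \<otimes>\<^bsub>G\<^esub> y) | x y. x \<in> carrier G \<and> y \<in> carrier G}"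

definition row_sum :: "('a, 'b) monoid_scheme \<Rightarrow> ('a \<times> 'a \<times> 'a \<Rightarrow> int) \<Rightarrow> 'a \<Rightarrow> int" where
  "row_sum G \<theta> g = (\<Sum>(x, y, z) \<in> {(x, y, z). (x, y, z) \<in> cayley_table G \<and> x = g}. \<theta> (x, y, z))"

definition col_sum :: "('a, 'b) monoid_scheme \<Rightarrow> ('a \<times> 'a \<times> 'a \<Rightarrow> int) \<Rightarrow> 'a \<Rightarrow> int" where
  "col_sum G \<theta> g = (\<Sum>(x, y, z) \<in> {(x, y, z). (x, y, z) \<in> cayley_table G \<and> y = g}. \<theta> (x, y, z))"

definition sym_sum :: "('a, 'b) monoid_scheme \<Rightarrow> ('a \<times> 'a \<times> 'a \<Rightarrow> int) \<Rightarrow> 'a \<Rightarrow> int" where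
  "sym_sum G \<theta> g = (\<Sum>(x, y, z) \<in> {(x, y, z). (x, y, z) \<in> cayley_table G \<and> z = g}. \<theta> (x, y, z))"

definition weight :: "('a, 'b) monoid_scheme \<Rightarrow> int \<Rightarrow> ('a \<times> 'a \<times> 'a \<Rightarrow> int) \<Rightarrow> bool" where
  "weight G k \<theta> \<longleftrightarrow>
     (\<forall>g \<in> carrier G. row_sum G \<theta> g = k \<and> col_sum G \<theta> g = k \<and> sym_sum G \<theta> g = k)"

definition partial_weight ::
  "('a, 'b) monoid_scheme \<Rightarrow> int \<Rightarrow> nat \<Rightarrow> ('a \<times> 'a \<times> 'a \<Rightarrow> int) \<Rightarrow> bool" where
  "partial_weight G k t \<theta> \<longleftrightarrow>
     card {g \<in> carrier G. row_sum G \<theta> g = k} = t \<and>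
     card {g \<in> carrier G. col_sum G \<theta> g = k} = t \<and>
     card {g \<in> carrier G. sym_sum G \<theta> g = k} = t \<and>
     (\<forall>g \<in> carrier G. row_sum G \<theta> g \<noteq> k \<longrightarrow> row_sum G \<theta> g = 0) \<and>
     (\<forall>g \<in> carrier G. col_sum G \<theta> g \<noteq> k \<longrightarrow> col_sum G \<theta> g = 0) \<and>
     (\<forall>g \<in> carrier G. sym_sum G \<theta> g \<noteq> k \<longrightarrow> sym_sum G \<theta> g = 0)"

definition near_weight :: "('a, 'b) monoid_scheme \<Rightarrow> int \<Rightarrow> ('a \<times> 'a \<times> 'a \<Rightarrow> int) \<Rightarrow> bool" where
  "near_weight G k \<theta> \<longleftrightarrow> partial_weight G k (order G - 1) \<theta>"

definition maximal_partial_weight ::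
  "('a, 'b) monoid_scheme \<Rightarrow> int \<Rightarrow> ('a \<times> 'a \<times> 'a \<Rightarrow> int) \<Rightarrow> bool" where
  "maximal_partial_weight G k \<theta> \<longleftrightarrow>
     (\<exists>t. partial_weight G k t \<theta>) \<and>
     \<not> (\<exists>\<theta>' t. partial_weight G k t \<theta>' \<and>
            (\<exists>c \<in> cayley_table G. \<theta>' c \<noteq> \<theta> c) \<and>
            (\<forall>c \<in> cayley_table G. \<theta> c \<le> \<theta>' c))"

text \<open>If all row and column sums are \<open>1\<close>, all symbol sums but two can vanish when the other two
  are multiples of \<open>n\<close>; the sums \<open>2 * n\<close> and \<open>- n\<close> occur in every group with \<open>n \<ge> 2\<close>. A claim
  that precisely \<open>n - 2\<close> symbol sums cannot be \<open>0\<close> must therefore exclude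
  the case that all symbol sums are multiples of \<open>n\<close>.\<close>

lemma (in comm_group) two_nonzero_sym_sums:
  assumes fin: "finite (carrier G)"
    and ab: "a \<in> carrier G" "b \<in> carrier G" "a \<noteq> b"
  defines "\<theta> \<equiv> \<lambda>(x, y, z). if z = a then 2 else if z = b then - 1 else (0::int)"
  shows "\<forall>g \<in> carrier G. row_sum G \<theta> g = 1 \<and> col_sum G \<theta> g = 1"
    and "\<forall>g \<in> carrier G. sym_sum G \<theta> g =
           (if g = a then 2 * int (order G) else if g = b then - int (order G) else 0)"
    and "card {g \<in> carrier G. sym_sum G \<theta> g = 0} = order G - 2"
proof -
  let ?f = "\<lambda>z. if z = a then 2 else if z = b then - 1 else (0::int)"
  have f: "(\<Sum>z \<in> carrier G. ?f z) = 1"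
  proof -
    have "(\<Sum>z \<in> carrier G. ?f z)
        = (\<Sum>z \<in> carrier G. (if z = a then 2 else 0) - (if z = b then 1 else 0))"
      using ab by (intro sum.cong) auto
    also have "\<dots> = 1" using ab fin by (simp add: sum_subtractf sum.delta)
    finally show ?thesis .
  qed
  have row: "row_sum G \<theta> g = 1" if g: "g \<in> carrier G" for g
  proof -
    have "row_sum G \<theta> g = (\<Sum>z \<in> carrier G. ?f z)"
      unfolding row_sum_def \<theta>_def using g
      by (intro sum.reindex_bij_witness[where i = "\<lambda>z. (g, inv g \<otimes> z, z)" and j = "\<lambda>(x, y, z). z"])
        (auto simp: cayley_table_def m_assoc[symmetric])
    with f show ?thesis by simp
  qed
  have col: "col_sum G \<theta> g = 1" if g: "g \<in> carrier G" for g
  proof -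
    have "col_sum G \<theta> g = (\<Sum>z \<in> carrier G. ?f z)"
      unfolding col_sum_def \<theta>_def using g
      by (intro sum.reindex_bij_witness[where i = "\<lambda>z. (z \<otimes> inv g, g, z)" and j = "\<lambda>(x, y, z). z"])
        (auto simp: cayley_table_def m_assoc)
    with f show ?thesis by simp
  qed
  show "\<forall>g \<in> carrier G. row_sum G \<theta> g = 1 \<and> col_sum G \<theta> g = 1"
    using row col by blast
  have sym: "sym_sum G \<theta> g = (if g = a then 2 * int (order G) else if g = b then - int (order G) else 0)"
    if g: "g \<in> carrier G" for g
  proof -
    have "sym_sum G \<theta> g = (\<Sum>x \<in> carrier G. ?f g)"
      unfolding sym_sum_def \<theta>_def using g
      by (intro sum.reindex_bij_witness[where i = "\<lambda>x. (x, inv x \<otimes> g, g)" and j = "\<lambda>(x, y, z). x"])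
        (auto simp: cayley_table_def m_assoc[symmetric])
    then show ?thesis by (simp add: order_def)
  qed
  then show "\<forall>g \<in> carrier G. sym_sum G \<theta> g =
      (if g = a then 2 * int (order G) else if g = b then - int (order G) else 0)"
    by blast
  have "order G > 0" using fin by (simp add: order_gt_0_iff_finite)
  then have "{g \<in> carrier G. sym_sum G \<theta> g = 0} = carrier G - {a, b}"
    using sym ab by auto
  then show "card {g \<in> carrier G. sym_sum G \<theta> g = 0} = order G - 2"
    using ab fin by (simp add: order_def card_Diff_subset)
qed

end

theory Submission
  imports Defs "HOL-Algebra.Multiplicative_Group"
begin

text \<open>
  Three ideas carry the proof.

  \<^emph>\<open>An obstruction.\<close> A cell \<open>(x, y, x \<otimes> y)\<close> satisfies the relation ``row times column equals
  symbol''. Raising this relation to the power \<open>\<theta>(x, y, x \<otimes> y)\<close> and multiplying over all cells shows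
  that the product of all rows, each raised to its row sum, times the analogous product for the
  columns is the analogous product for the symbols (\<open>prod_row_sums_col_sums\<close>). It is most effective
  on a difference of two functions whose sums almost agree, because then only few factors remain.
  If a \<open>1\<close>-weight exists and \<open>\<theta>\<close> is a near \<open>1\<close>-weight that misses row \<open>a\<close>, column \<open>b\<close> and symbol \<open>c\<close>,
  then the difference gives \<open>a \<otimes> b = c\<close>, so \<open>\<theta>\<close> can be increased by \<open>1\<close> in the cell \<open>(a, b, c)\<close> and is not
  maximal. If all row and column sums of \<open>\<theta>\<close> are \<open>1\<close>, and its only symbol sums that can be nonzero
  are \<open>n - i\<close> at \<open>a\<close> and \<open>i\<close> at \<open>b\<close>, then subtracting the indicator function of the cells with symbol \<open>a\<close>
  gives \<open>b\<^sup>i = a\<^sup>i\<close>; this forces \<open>a = b\<close> when \<open>i\<close> is coprime to the group order.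

  \<^emph>\<open>A construction.\<close> Start with the cells containing the symbol \<open>\<one>\<close>: all row and column sums are \<open>1\<close>,
  and the symbol sum \<open>n\<close> is concentrated at \<open>\<one>\<close>. Changing \<open>\<theta>\<close> by \<open>\<plusminus>1\<close> in the corners of a rectangle of
  cells preserves all row and column sums. The rectangle with rows \<open>\<one>, p\<close> and columns \<open>\<one>, a\<close> contains the
  symbols \<open>\<one>, a, p, p \<otimes> a\<close>, so it moves one unit of symbol sum from \<open>\<one>\<close> to \<open>a\<close> while the
  defect \<open>p\<close> is replaced by \<open>p \<otimes> a\<close>. Doing this for every \<open>a\<close> in turn leaves all symbol sums equal to
  \<open>1\<close>, except for one unit too much at \<open>\<one>\<close> and one unit missing at the product \<open>P\<close> of all group
  elements (\<open>exists_switched\<close>). If \<open>P = \<one>\<close>, the two errors cancel and this is a \<open>1\<close>-weight.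
  Otherwise, decreasing the cell \<open>(\<one>, \<one>, \<one>)\<close> by \<open>1\<close> yields a near \<open>1\<close>-weight.

  \<^emph>\<open>A count.\<close> The entries of a partial \<open>1\<close>-weight of length \<open>t\<close> sum to \<open>t\<close>. Hence whatever strictly
  dominates a near \<open>1\<close>-weight has length \<open>n\<close>, that is, it is a \<open>1\<close>-weight. So in the absence of
  \<open>1\<close>-weights the near \<open>1\<close>-weight above is maximal.
\<close>

section \<open>Sums along the lines of a latin square\<close>

text \<open>Rows, columns and symbols enter symmetrically into most arguments; the three kinds of sums
  are the instances of \<open>line_sum\<close> for the three coordinate projections.\<close>

definition line_sum :: "'c set \<Rightarrow> ('c \<Rightarrow> 'g) \<Rightarrow> ('c \<Rightarrow> int) \<Rightarrow> 'g \<Rightarrow> int" where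
  "line_sum L \<pi> \<theta> g = (\<Sum>c \<in> {c \<in> L. \<pi> c = g}. \<theta> c)"

lemma row_sum_eq_line_sum: "row_sum G \<theta> g = line_sum (cayley_table G) fst \<theta> g"
  unfolding row_sum_def line_sum_def by (rule sum.cong) auto

lemma col_sum_eq_line_sum: "col_sum G \<theta> g = line_sum (cayley_table G) (fst \<circ> snd) \<theta> g"
  unfolding col_sum_def line_sum_def by (rule sum.cong) auto

lemma sym_sum_eq_line_sum: "sym_sum G \<theta> g = line_sum (cayley_table G) (snd \<circ> snd) \<theta> g"
  unfolding sym_sum_def line_sum_def by (rule sum.cong) auto

lemmas sums_eq_line_sum = row_sum_eq_line_sum col_sum_eq_line_sum sym_sum_eq_line_sum

lemma line_sum_diff:
  "line_sum L \<pi> (\<lambda>c. \<theta> c - \<eta> c) g = line_sum L \<pi> \<theta> g - line_sum L \<pi> \<eta> g"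
  unfolding line_sum_def by (rule sum_subtractf)

lemma line_sum_update:
  assumes "finite L" "c \<in> L"
  shows "line_sum L \<pi> (\<theta>(c := \<theta> c + k)) g = line_sum L \<pi> \<theta> g + (if \<pi> c = g then k else 0)"
proof -
  have "line_sum L \<pi> (\<theta>(c := \<theta> c + k)) g
      = (\<Sum>d \<in> {d \<in> L. \<pi> d = g}. \<theta> d + (if d = c then k else 0))"
    unfolding line_sum_def by (rule sum.cong) auto
  also have "\<dots> = line_sum L \<pi> \<theta> g + (if \<pi> c = g then k else 0)"
    using assms by (simp add: line_sum_def sum.distrib sum.delta)
  finally show ?thesis .
qed

lemma sum_line_sum:
  assumes "finite L" "finite A" "\<pi> ` L \<subseteq> A"
  shows "(\<Sum>g \<in> A. line_sum L \<pi> \<theta> g) = (\<Sum>c \<in> L. \<theta> c)"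
  unfolding line_sum_def by (rule sum.group) (use assms in auto)

lemma sum_eq_card_if_values_0_1:
  fixes f :: "'a \<Rightarrow> int"
  assumes "finite A" "\<forall>g \<in> A. f g \<noteq> 1 \<longrightarrow> f g = 0"
  shows "(\<Sum>g \<in> A. f g) = int (card {g \<in> A. f g = 1})"
proof -
  have "(\<Sum>g \<in> A. f g) = (\<Sum>g \<in> A. if f g = 1 then 1 else 0)"
    using assms by (intro sum.cong) auto
  also have "\<dots> = int (card {g \<in> A. f g = 1})"
    using assms by (simp add: sum.If_cases Int_def)
  finally show ?thesis .
qed

lemma eq_indicator_if_card_eq_pred:
  fixes f :: "'a \<Rightarrow> int"
  assumes "finite A" "A \<noteq> {}" "card {g \<in> A. f g = 1} = card A - 1"
    and "\<forall>g \<in> A. f g \<noteq> 1 \<longrightarrow> f g = 0"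
  obtains a where "a \<in> A" "\<And>g. g \<in> A \<Longrightarrow> f g = (if g = a then 0 else 1)"
proof -
  have pos: "card A \<noteq> 0" using assms by simp
  have "card (A - {g \<in> A. f g = 1}) = card A - card {g \<in> A. f g = 1}"
    using assms(1) by (intro card_Diff_subset) auto
  also have "\<dots> = 1" using assms(3) pos by simp
  finally obtain a where a: "A - {g \<in> A. f g = 1} = {a}" by (auto simp: card_1_singleton_iff)
  show thesis
  proof
    show "a \<in> A" using a by blast
    show "f g = (if g = a then 0 else 1)" if "g \<in> A" for g
      using a assms(4) that by auto
  qed
qed

section \<open>The product relation between row, column and symbol sums\<close>

lemma (in comm_group) finprod_int_pow_const:
  assumes "finite S" "g \<in> carrier G"
  shows "(\<Otimes>c \<in> S. g [^] (e c :: int)) = g [^] (\<Sum>c \<in> S. e c)"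
  using assms by (induction S rule: finite_induct) (auto simp: int_pow_mult)

text \<open>Factors with the same base \<open>g\<close> come from one line, and their exponents add up to its sum. This is
  the step that turns a product over cells into one that only depends on the line sums.\<close>

lemma (in comm_group) finprod_line_sum:
  assumes "finite (carrier G)" "finite L" "\<pi> ` L \<subseteq> carrier G"
  shows "(\<Otimes>c \<in> L. \<pi> c [^] \<theta> c) = (\<Otimes>g \<in> carrier G. g [^] line_sum L \<pi> \<theta> g)"
proof -
  have L: "L = (\<Union>g \<in> carrier G. {c \<in> L. \<pi> c = g})" using assms(3) by auto
  have "(\<Otimes>c \<in> L. \<pi> c [^] \<theta> c) = (\<Otimes>g \<in> carrier G. \<Otimes>c \<in> {c \<in> L. \<pi> c = g}. \<pi> c [^] \<theta> c)"
    by (subst L, rule finprod_UN_disjoint) (use assms in \<open>auto simp: pairwise_def disjnt_def\<close>)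
  also have "\<dots> = (\<Otimes>g \<in> carrier G. g [^] line_sum L \<pi> \<theta> g)"
  proof (rule finprod_cong')
    fix g assume g: "g \<in> carrier G"
    have "(\<Otimes>c \<in> {c \<in> L. \<pi> c = g}. \<pi> c [^] \<theta> c) = (\<Otimes>c \<in> {c \<in> L. \<pi> c = g}. g [^] \<theta> c)"
      using g by (intro finprod_cong') auto
    then show "(\<Otimes>c \<in> {c \<in> L. \<pi> c = g}. \<pi> c [^] \<theta> c) = g [^] line_sum L \<pi> \<theta> g"
      using assms g by (simp add: finprod_int_pow_const line_sum_def)
  qed auto
  finally show ?thesis .
qed

lemma finite_cayley_table: "finite (carrier G) \<Longrightarrow> finite (cayley_table G)"
  by (rule finite_subset[where B = "(\<lambda>(x, y). (x, y, x \<otimes>\<^bsub>G\<^esub> y)) ` (carrier G \<times> carrier G)"])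
    (auto simp: cayley_table_def)

lemma (in group) cayley_table_projections:
  "fst ` cayley_table G \<subseteq> carrier G"
  "(fst \<circ> snd) ` cayley_table G \<subseteq> carrier G"
  "(snd \<circ> snd) ` cayley_table G \<subseteq> carrier G"
  by (auto simp: cayley_table_def)

text \<open>The relation \<open>x\<^sup>k \<otimes> y\<^sup>k = (x \<otimes> y)\<^sup>k\<close> with \<open>k = \<theta>(x, y, x \<otimes> y)\<close>, multiplied over all cells. It uses
  commutativity already in a single cell.\<close>

lemma (in comm_group) prod_row_sums_col_sums:
  assumes fin: "finite (carrier G)"
  shows "(\<Otimes>g \<in> carrier G. g [^] row_sum G \<theta> g) \<otimes> (\<Otimes>g \<in> carrier G. g [^] col_sum G \<theta> g)
       = (\<Otimes>g \<in> carrier G. g [^] sym_sum G \<theta> g)"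
proof -
  let ?L = "cayley_table G"
  note collect = finprod_line_sum[OF fin finite_cayley_table[OF fin], symmetric]
  have "(\<Otimes>c \<in> ?L. fst c [^] \<theta> c) \<otimes> (\<Otimes>c \<in> ?L. (fst \<circ> snd) c [^] \<theta> c)
      = (\<Otimes>c \<in> ?L. fst c [^] \<theta> c \<otimes> (fst \<circ> snd) c [^] \<theta> c)"
    by (rule finprod_multf[symmetric]) (auto simp: cayley_table_def)
  also have "\<dots> = (\<Otimes>c \<in> ?L. (snd \<circ> snd) c [^] \<theta> c)"
    by (rule finprod_cong') (auto simp: cayley_table_def int_pow_distrib)
  finally show ?thesis
    by (simp only: sums_eq_line_sum collect cayley_table_projections)
qed

lemma (in comm_group) finprod_int_pow_delta:
  assumes "finite (carrier G)" "a \<in> carrier G"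
    and "\<And>g. g \<in> carrier G \<Longrightarrow> e g = (if g = a then k else (0::int))"
  shows "(\<Otimes>g \<in> carrier G. g [^] e g) = a [^] k"
proof -
  have "(\<Otimes>g \<in> carrier G. g [^] e g) = (\<Otimes>g \<in> carrier G. if a = g then g [^] k else \<one>)"
    using assms by (intro finprod_cong') auto
  also have "\<dots> = a [^] k"
    using assms by (intro finprod_singleton) auto
  finally show ?thesis .
qed

section \<open>Weights, partial weights and near weights\<close>

lemma (in group) partial_weight_total:
  assumes fin: "finite (carrier G)" and "partial_weight G 1 t \<theta>"
  shows "(\<Sum>c \<in> cayley_table G. \<theta> c) = int t"
proof -
  have "(\<Sum>g \<in> carrier G. row_sum G \<theta> g) = int (card {g \<in> carrier G. row_sum G \<theta> g = 1})"
    using assms unfolding partial_weight_def by (intro sum_eq_card_if_values_0_1) auto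
  then show ?thesis
    using assms sum_line_sum[OF finite_cayley_table[OF fin] fin cayley_table_projections(1)]
    by (simp add: row_sum_eq_line_sum partial_weight_def)
qed

lemma weight_iff_partial_weight_order:
  assumes fin: "finite (carrier G)" and nonempty: "carrier G \<noteq> {}"
  shows "weight G 1 \<theta> \<longleftrightarrow> partial_weight G 1 (order G) \<theta>"
proof -
  have full: "card {g \<in> carrier G. f g = (1::int)} = order G \<longleftrightarrow> (\<forall>g \<in> carrier G. f g = 1)"
    for f
  proof
    assume "card {g \<in> carrier G. f g = 1} = order G"
    then have "{g \<in> carrier G. f g = 1} = carrier G"
      using fin by (intro card_subset_eq) (auto simp: order_def)
    then show "\<forall>g \<in> carrier G. f g = 1" by blast
  next
    assume "\<forall>g \<in> carrier G. f g = 1"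
    then have "{g \<in> carrier G. f g = 1} = carrier G" by blast
    then show "card {g \<in> carrier G. f g = 1} = order G" by (simp add: order_def)
  qed
  show ?thesis unfolding weight_def partial_weight_def full by auto
qed

text \<open>A strictly dominating partial \<open>1\<close>-weight has a larger total than \<open>n - 1\<close>, so its length is \<open>n\<close>.\<close>

lemma (in group) near_weight_maximal:
  assumes fin: "finite (carrier G)" and near: "near_weight G 1 \<theta>"
    and no_weight: "\<nexists>\<theta>. weight G 1 \<theta>"
  shows "maximal_partial_weight G 1 \<theta>"
  unfolding maximal_partial_weight_def
proof (intro conjI notI)
  show "\<exists>t. partial_weight G 1 t \<theta>" using near unfolding near_weight_def by blast
next
  assume "\<exists>\<theta>' t. partial_weight G 1 t \<theta>' \<and>
      (\<exists>c \<in> cayley_table G. \<theta>' c \<noteq> \<theta> c) \<and> (\<forall>c \<in> cayley_table G. \<theta> c \<le> \<theta>' c)"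
  then obtain \<theta>' t c where t: "partial_weight G 1 t \<theta>'"
    and c: "c \<in> cayley_table G" "\<theta>' c \<noteq> \<theta> c" and le: "\<forall>c \<in> cayley_table G. \<theta> c \<le> \<theta>' c"
    by blast
  have "(\<Sum>c \<in> cayley_table G. \<theta> c) < (\<Sum>c \<in> cayley_table G. \<theta>' c)"
    using c le by (intro sum_strict_mono_ex1 finite_cayley_table fin) force+
  then have "int (order G - 1) < int t"
    using partial_weight_total[OF fin] t near unfolding near_weight_def by metis
  moreover have "t \<le> order G"
  proof -
    have "t = card {g \<in> carrier G. row_sum G \<theta>' g = 1}" using t unfolding partial_weight_def by simp
    also have "\<dots> \<le> order G" unfolding order_def using fin by (intro card_mono) auto
    finally show ?thesis .
  qed
  ultimately have "t = order G" by linarith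
  then have "weight G 1 \<theta>'"
    using t fin weight_iff_partial_weight_order by blast
  then show False using no_weight by blast
qed

section \<open>Constructing weights and near weights by switching\<close>

text \<open>Each symbol occurs once in every row and column, so the cells of one symbol give the simplest
  function with all row and column sums \<open>1\<close>. It is the starting point of the switching, and it is
  subtracted from other such functions in order to make the row and column sums vanish.\<close>

lemma (in comm_group) indicator_symbol_sums:
  assumes fin: "finite (carrier G)" and a: "a \<in> carrier G" and g: "g \<in> carrier G"
  defines "\<eta> \<equiv> \<lambda>(x, y, z). if z = a then 1 else 0"
  shows "row_sum G \<eta> g = 1" "col_sum G \<eta> g = 1"
    and "sym_sum G \<eta> g = (if g = a then int (order G) else 0)"
proof -
  have "row_sum G \<eta> g = (\<Sum>z \<in> carrier G. if z = a then 1 else 0)"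
    unfolding row_sum_def \<eta>_def using g
    by (intro sum.reindex_bij_witness[where i = "\<lambda>z. (g, inv g \<otimes> z, z)" and j = "\<lambda>(x, y, z). z"])
      (auto simp: cayley_table_def m_assoc[symmetric])
  then show "row_sum G \<eta> g = 1" using fin a by simp
  have "col_sum G \<eta> g = (\<Sum>z \<in> carrier G. if z = a then 1 else 0)"
    unfolding col_sum_def \<eta>_def using g
    by (intro sum.reindex_bij_witness[where i = "\<lambda>z. (z \<otimes> inv g, g, z)" and j = "\<lambda>(x, y, z). z"])
      (auto simp: cayley_table_def m_assoc)
  then show "col_sum G \<eta> g = 1" using fin a by simp
  have "sym_sum G \<eta> g = (\<Sum>x \<in> carrier G. if g = a then 1 else 0)"
    unfolding sym_sum_def \<eta>_def using g
    by (intro sum.reindex_bij_witness[where i = "\<lambda>x. (x, inv x \<otimes> g, g)" and j = "\<lambda>(x, y, z). x"])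
      (auto simp: cayley_table_def m_assoc[symmetric])
  then show "sym_sum G \<eta> g = (if g = a then int (order G) else 0)" by (simp add: order_def)
qed

definition add_cell ::
  "('a, 'b) monoid_scheme \<Rightarrow> 'a \<Rightarrow> 'a \<Rightarrow> int \<Rightarrow> ('a \<times> 'a \<times> 'a \<Rightarrow> int) \<Rightarrow> 'a \<times> 'a \<times> 'a \<Rightarrow> int" where
  "add_cell G x y k \<theta> = \<theta>((x, y, x \<otimes>\<^bsub>G\<^esub> y) := \<theta> (x, y, x \<otimes>\<^bsub>G\<^esub> y) + k)"

lemma add_cell_sums:
  assumes "finite (carrier G)" "x \<in> carrier G" "y \<in> carrier G"
  shows "row_sum G (add_cell G x y k \<theta>) g = row_sum G \<theta> g + (if x = g then k else 0)"
    and "col_sum G (add_cell G x y k \<theta>) g = col_sum G \<theta> g + (if y = g then k else 0)"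
    and "sym_sum G (add_cell G x y k \<theta>) g = sym_sum G \<theta> g + (if x \<otimes>\<^bsub>G\<^esub> y = g then k else 0)"
proof -
  have "(x, y, x \<otimes>\<^bsub>G\<^esub> y) \<in> cayley_table G" using assms by (auto simp: cayley_table_def)
  note upd = line_sum_update[OF finite_cayley_table[OF assms(1)] this]
  show "row_sum G (add_cell G x y k \<theta>) g = row_sum G \<theta> g + (if x = g then k else 0)"
    "col_sum G (add_cell G x y k \<theta>) g = col_sum G \<theta> g + (if y = g then k else 0)"
    "sym_sum G (add_cell G x y k \<theta>) g = sym_sum G \<theta> g + (if x \<otimes>\<^bsub>G\<^esub> y = g then k else 0)"
    by (simp_all add: sums_eq_line_sum add_cell_def upd)
qed

text \<open>One rectangle of cells is switched for each element of \<open>A\<close>. The invariant also makes sense for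
  \<open>A = {}\<close>, where the empty product \<open>\<one>\<close> absorbs the surplus over the symbol sum \<open>n\<close> at \<open>\<one>\<close>. A
  switch is a sum of four cell changes, so its contributions also add up correctly in the degenerate
  case in which some of its cells coincide.\<close>

lemma (in comm_group) exists_switched:
  assumes fin: "finite (carrier G)" and A: "A \<subseteq> carrier G"
  shows "\<exists>\<theta>. \<forall>g \<in> carrier G. row_sum G \<theta> g = 1 \<and> col_sum G \<theta> g = 1 \<and>
           sym_sum G \<theta> g = (if g \<in> A then 1 else 0)
             + (if \<one> = g then int (order G) - int (card A) + 1 else 0)
             - (if (\<Otimes>a \<in> A. a) = g then 1 else 0)"
proof -
  have "finite A" using A fin by (rule finite_subset)
  then show ?thesis using A
  proof (induction A rule: finite_induct)
    case empty
    let ?\<eta> = "\<lambda>(x, y, z). if z = \<one> then 1 else (0::int)"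
    show ?case
      by (rule exI[of _ ?\<eta>]) (auto simp: indicator_symbol_sums[OF fin one_closed])
  next
    case (insert a A)
    let ?p = "\<Otimes>a \<in> A. a"
    have a: "a \<in> carrier G" and A: "A \<subseteq> carrier G" using insert.prems by auto
    then have p: "?p \<in> carrier G" by (intro finprod_closed) auto
    have prod: "(\<Otimes>a \<in> insert a A. a) = ?p \<otimes> a"
      using insert.hyps a A p m_comm by (subst finprod_insert) auto
    obtain \<theta> where \<theta>: "\<And>g. g \<in> carrier G \<Longrightarrow> row_sum G \<theta> g = 1 \<and> col_sum G \<theta> g = 1 \<and>
        sym_sum G \<theta> g = (if g \<in> A then 1 else 0)
          + (if \<one> = g then int (order G) - int (card A) + 1 else 0) - (if ?p = g then 1 else 0)"
      using insert.IH[OF A] by blast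
    \<comment> \<open>The corners contribute \<open>+1\<close> at \<open>a\<close>, \<open>+1\<close> at \<open>p\<close> (repairing the old defect), \<open>-1\<close> at \<open>\<one>\<close> and \<open>-1\<close>
      at \<open>p \<otimes> a\<close> (the new defect).\<close>
    let ?\<theta> = "add_cell G \<one> a 1 (add_cell G ?p \<one> 1 (add_cell G \<one> \<one> (-1) (add_cell G ?p a (-1) \<theta>)))"
    show ?case
    proof (intro exI[of _ ?\<theta>] ballI)
      fix g assume g: "g \<in> carrier G"
      show "row_sum G ?\<theta> g = 1 \<and> col_sum G ?\<theta> g = 1 \<and>
          sym_sum G ?\<theta> g = (if g \<in> insert a A then 1 else 0)
            + (if \<one> = g then int (order G) - int (card (insert a A)) + 1 else 0)
            - (if (\<Otimes>a \<in> insert a A. a) = g then 1 else 0)"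
        unfolding prod using insert.hyps a p \<theta>[OF g]
        by (simp add: add_cell_sums[OF fin]) auto
    qed
  qed
qed

lemma (in comm_group) weight_or_near_weight:
  assumes fin: "finite (carrier G)"
  shows "(\<exists>\<theta>. weight G 1 \<theta>) \<or> (\<exists>\<theta>. near_weight G 1 \<theta>)"
proof -
  let ?P = "\<Otimes>a \<in> carrier G. a"
  have P: "?P \<in> carrier G" by (intro finprod_closed) auto
  have "\<exists>\<theta>. \<forall>g \<in> carrier G. row_sum G \<theta> g = 1 \<and> col_sum G \<theta> g = 1 \<and>
      sym_sum G \<theta> g = 1 + (if \<one> = g then 1 else 0) - (if ?P = g then 1 else 0)"
    using exists_switched[OF fin subset_refl] by (auto simp only: order_def simp_thms if_True diff_self add_0)
  then obtain \<theta> where \<theta>: "\<And>g. g \<in> carrier G \<Longrightarrow> row_sum G \<theta> g = 1 \<and> col_sum G \<theta> g = 1 \<and>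
      sym_sum G \<theta> g = 1 + (if \<one> = g then 1 else 0) - (if ?P = g then 1 else 0)"
    by blast
  show ?thesis
  proof (cases "?P = \<one>")
    case True
    then have "weight G 1 \<theta>" using \<theta> unfolding weight_def by auto
    then show ?thesis by blast
  next
    case False
    let ?\<theta> = "add_cell G \<one> \<one> (-1) \<theta>"
    have sums: "row_sum G ?\<theta> g = (if g = \<one> then 0 else 1)"
      "col_sum G ?\<theta> g = (if g = \<one> then 0 else 1)"
      "sym_sum G ?\<theta> g = (if g = ?P then 0 else 1)" if "g \<in> carrier G" for g
      using \<theta>[OF that] False by (auto simp: add_cell_sums[OF fin])
    have "card {g \<in> carrier G. f g = 1} = order G - 1"
      if "\<And>g. g \<in> carrier G \<Longrightarrow> f g = (if g = a then 0 else (1::int))" "a \<in> carrier G" for f a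
    proof -
      have "{g \<in> carrier G. f g = 1} = carrier G - {a}" using that by auto
      then show ?thesis using fin that(2) by (simp add: order_def)
    qed
    then have "near_weight G 1 ?\<theta>"
      unfolding near_weight_def partial_weight_def using sums P by auto
    then show ?thesis by blast
  qed
qed

section \<open>Consequences of the product relation\<close>

text \<open>The difference of a \<open>1\<close>-weight and a near \<open>1\<close>-weight has the sums of a single cell: \<open>1\<close> in one
  row, one column and one symbol, and \<open>0\<close> otherwise. The product relation says that these three
  lines do meet in a cell, where the near \<open>1\<close>-weight can then be increased.\<close>

lemma (in comm_group) weight_imp_near_weight_not_maximal:
  assumes fin: "finite (carrier G)" and w: "weight G 1 w" and near: "near_weight G 1 \<theta>"
  shows "\<not> maximal_partial_weight G 1 \<theta>"
proof -
  note missing = eq_indicator_if_card_eq_pred[OF fin, folded order_def]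
  have nonempty: "carrier G \<noteq> {}" by auto
  note near' = near[unfolded near_weight_def partial_weight_def]
  obtain a where a: "a \<in> carrier G"
    "\<And>g. g \<in> carrier G \<Longrightarrow> row_sum G \<theta> g = (if g = a then 0 else 1)"
    using missing[of "row_sum G \<theta>"] nonempty near' by blast
  obtain b where b: "b \<in> carrier G"
    "\<And>g. g \<in> carrier G \<Longrightarrow> col_sum G \<theta> g = (if g = b then 0 else 1)"
    using missing[of "col_sum G \<theta>"] nonempty near' by blast
  obtain c where c: "c \<in> carrier G"
    "\<And>g. g \<in> carrier G \<Longrightarrow> sym_sum G \<theta> g = (if g = c then 0 else 1)"
    using missing[of "sym_sum G \<theta>"] nonempty near' by blast
  let ?d = "\<lambda>c. w c - \<theta> c"
  have d: "row_sum G ?d g = (if g = a then 1 else 0)" "col_sum G ?d g = (if g = b then 1 else 0)"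
    "sym_sum G ?d g = (if g = c then 1 else 0)" if "g \<in> carrier G" for g
    using a(2)[OF that] b(2)[OF that] c(2)[OF that] w that
    by (auto simp: weight_def sums_eq_line_sum line_sum_diff)
  have ab: "a \<otimes> b = c"
  proof -
    have "(\<Otimes>g \<in> carrier G. g [^] row_sum G ?d g) = a"
      using finprod_int_pow_delta[OF fin a(1), of "row_sum G ?d"] d(1) a(1) by (simp add: int_pow_1)
    moreover have "(\<Otimes>g \<in> carrier G. g [^] col_sum G ?d g) = b"
      using finprod_int_pow_delta[OF fin b(1), of "col_sum G ?d"] d(2) b(1) by (simp add: int_pow_1)
    moreover have "(\<Otimes>g \<in> carrier G. g [^] sym_sum G ?d g) = c"
      using finprod_int_pow_delta[OF fin c(1), of "sym_sum G ?d"] d(3) c(1) by (simp add: int_pow_1)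
    ultimately show ?thesis using prod_row_sums_col_sums[OF fin, of ?d] by simp
  qed
  let ?\<theta> = "add_cell G a b 1 \<theta>"
  have "weight G 1 ?\<theta>"
    unfolding weight_def using a b c ab by (simp add: add_cell_sums[OF fin])
  then have "partial_weight G 1 (order G) ?\<theta>"
    using weight_iff_partial_weight_order[OF fin nonempty] by blast
  moreover have "(a, b, a \<otimes> b) \<in> cayley_table G" "?\<theta> (a, b, a \<otimes> b) \<noteq> \<theta> (a, b, a \<otimes> b)"
    using a(1) b(1) by (auto simp: cayley_table_def add_cell_def)
  moreover have "\<forall>c \<in> cayley_table G. \<theta> c \<le> ?\<theta> c" by (simp add: add_cell_def)
  ultimately show ?thesis unfolding maximal_partial_weight_def by blast
qed

text \<open>If \<open>u * i + v * n = 1\<close>, then raising to the power \<open>u\<close> inverts raising to the power \<open>i\<close>,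
  because \<open>n\<close>-th powers are trivial.\<close>

lemma (in group) int_pow_inj_if_coprime_order:
  assumes fin: "finite (carrier G)" and cop: "coprime (int (order G)) i"
    and ab: "a \<in> carrier G" "b \<in> carrier G" and eq: "a [^] i = b [^] i"
  shows "a = b"
proof -
  obtain u v where uv: "u * i + v * int (order G) = 1"
    using bezout_int[of i "int (order G)"] cop by (auto simp: coprime_iff_gcd_eq_1 gcd.commute)
  have "x = (x [^] i) [^] u" if x: "x \<in> carrier G" for x
  proof -
    have "x = x [^] (i * u + int (order G) * v)" using x uv by (simp add: int_pow_1 mult.commute)
    also have "\<dots> = (x [^] i) [^] u \<otimes> (x [^] int (order G)) [^] v"
      using x by (simp add: int_pow_mult int_pow_pow)
    also have "\<dots> = (x [^] i) [^] u"
      using x fin by (simp add: int_pow_int pow_order_eq_1)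
    finally show ?thesis .
  qed
  then show ?thesis using ab eq by metis
qed

text \<open>Subtracting the indicator of the symbol \<open>a\<close> removes all row and column sums and leaves the symbol
  sums \<open>-i\<close> at \<open>a\<close> and \<open>i\<close> at \<open>b\<close>, so the product relation reads \<open>\<one> = a\<^sup>-\<^sup>i \<otimes> b\<^sup>i\<close>.\<close>

lemma (in comm_group) no_two_coprime_sym_sums:
  assumes fin: "finite (carrier G)"
    and one: "\<forall>g \<in> carrier G. row_sum G \<theta> g = 1 \<and> col_sum G \<theta> g = 1"
    and cop: "coprime (int (order G)) i" and ab: "a \<in> carrier G" "b \<in> carrier G" "a \<noteq> b"
    and sa: "sym_sum G \<theta> a = int (order G) - i" and sb: "sym_sum G \<theta> b = i"
    and zero: "\<forall>g \<in> carrier G - {a, b}. sym_sum G \<theta> g = 0"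
  shows False
proof -
  let ?\<eta> = "\<lambda>(x, y, z). if z = a then 1 else (0::int)"
  let ?d = "\<lambda>c. \<theta> c - ?\<eta> c"
  note \<eta> = indicator_symbol_sums[OF fin ab(1)]
  have diff: "row_sum G ?d g = row_sum G \<theta> g - row_sum G ?\<eta> g"
    "col_sum G ?d g = col_sum G \<theta> g - col_sum G ?\<eta> g"
    "sym_sum G ?d g = sym_sum G \<theta> g - sym_sum G ?\<eta> g" for g
    by (simp_all only: sums_eq_line_sum line_sum_diff)
  have rc: "row_sum G ?d g = 0" "col_sum G ?d g = 0" if "g \<in> carrier G" for g
    using one that \<eta>[OF that] unfolding diff by auto
  have s: "sym_sum G ?d g = (if g = a then - i else 0) + (if g = b then i else 0)"
    if "g \<in> carrier G" for g
    using zero that \<eta>(3)[OF that] ab sa sb unfolding diff by auto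
  have triv: "(\<Otimes>g \<in> carrier G. g [^] e g) = \<one>" if "\<And>g. g \<in> carrier G \<Longrightarrow> e g = (0::int)" for e
    using finprod_int_pow_delta[OF fin one_closed, of e 0] that by simp
  have "(\<Otimes>g \<in> carrier G. g [^] sym_sum G ?d g)
      = (\<Otimes>g \<in> carrier G. g [^] (if g = a then - i else 0) \<otimes> g [^] (if g = b then i else 0))"
    by (rule finprod_cong') (auto simp: s int_pow_mult[symmetric])
  also have "\<dots> = a [^] (- i) \<otimes> b [^] i"
    using finprod_int_pow_delta[OF fin ab(1) refl, of "- i"] finprod_int_pow_delta[OF fin ab(2) refl, of i]
    by (subst finprod_multf) auto
  finally have "a [^] (- i) \<otimes> b [^] i = \<one>"
    using prod_row_sums_col_sums[OF fin, of ?d] triv[OF rc(1)] triv[OF rc(2)] by simp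
  then have "a [^] i = b [^] i"
    using ab by (metis int_pow_closed int_pow_neg inv_equality inv_inv inv_closed)
  then show False using int_pow_inj_if_coprime_order[OF fin cop] ab by blast
qed

text \<open>The symbol sums add up to \<open>n\<close>, so two nonzero ones are \<open>n - i\<close> and \<open>i\<close>, and for prime \<open>n\<close> the
  only alternative to coprimality is that \<open>n\<close> divides both.\<close>

lemma (in comm_group) no_two_nonzero_sym_sums_prime_order:
  assumes fin: "finite (carrier G)"
    and one: "\<forall>g \<in> carrier G. row_sum G \<theta> g = 1 \<and> col_sum G \<theta> g = 1"
    and prime: "prime (order G)"
    and card: "card {g \<in> carrier G. sym_sum G \<theta> g = 0} = order G - 2"
    and ndvd: "\<exists>g \<in> carrier G. \<not> int (order G) dvd sym_sum G \<theta> g"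
  shows False
proof -
  let ?n = "int (order G)" and ?Z = "{g \<in> carrier G. sym_sum G \<theta> g = 0}"
  have "card (carrier G - ?Z) = order G - card ?Z"
    unfolding order_def using fin by (intro card_Diff_subset) auto
  also have "\<dots> = 2" using card prime_ge_2_nat[OF prime] by simp
  finally obtain a b where ab: "carrier G - ?Z = {a, b}" "a \<noteq> b" by (auto simp: card_2_iff)
  then have mem: "a \<in> carrier G" "b \<in> carrier G" by blast+
  have zero: "\<forall>g \<in> carrier G - {a, b}. sym_sum G \<theta> g = 0" using ab by blast
  note total = sum_line_sum[OF finite_cayley_table[OF fin] fin, of _ \<theta>]
  have "(\<Sum>g \<in> carrier G. sym_sum G \<theta> g) = (\<Sum>g \<in> carrier G. row_sum G \<theta> g)"
    unfolding sums_eq_line_sum by (simp only: total cayley_table_projections)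
  also have "\<dots> = ?n" using one by (simp add: order_def)
  also have "(\<Sum>g \<in> carrier G. sym_sum G \<theta> g) = (\<Sum>g \<in> {a, b}. sym_sum G \<theta> g)"
    using fin mem zero by (intro sum.mono_neutral_right) auto
  finally have sum: "sym_sum G \<theta> a = ?n - sym_sum G \<theta> b" using ab(2) by simp
  have "\<not> ?n dvd sym_sum G \<theta> b"
  proof
    assume dvd: "?n dvd sym_sum G \<theta> b"
    then have "?n dvd sym_sum G \<theta> a" unfolding sum by (intro dvd_diff) auto
    then have "?n dvd sym_sum G \<theta> g" if "g \<in> carrier G" for g
      using dvd zero that by (cases "g = a \<or> g = b") auto
    then show False using ndvd by blast
  qed
  then have "coprime ?n (sym_sum G \<theta> b)"
    using prime by (intro prime_imp_coprime) auto
  then show False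
    using no_two_coprime_sym_sums[OF fin one _ mem ab(2) sum refl zero] by blast
qed

theorem theorem7:
  fixes G :: "('a, 'b) monoid_scheme" and n :: nat
  assumes "comm_group G" and "finite (carrier G)" and "order G = n"
  shows
    "((\<exists>\<theta>. weight G 1 \<theta>) \<or> (\<exists>\<theta>. near_weight G 1 \<theta> \<and> maximal_partial_weight G 1 \<theta>)) \<and>
     \<not> ((\<exists>\<theta>. weight G 1 \<theta>) \<and> (\<exists>\<theta>. near_weight G 1 \<theta> \<and> maximal_partial_weight G 1 \<theta>)) \<and>
     (\<forall>\<theta>. (\<forall>g \<in> carrier G. row_sum G \<theta> g = 1 \<and> col_sum G \<theta> g = 1) \<longrightarrow>
        \<not> (\<exists>i a b. coprime (int n) i \<and> a \<in> carrier G \<and> b \<in> carrier G \<and> a \<noteq> b \<and>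
              sym_sum G \<theta> a = int n - i \<and> sym_sum G \<theta> b = i \<and>
              (\<forall>g \<in> carrier G - {a, b}. sym_sum G \<theta> g = 0)) \<and>
        (prime n \<longrightarrow>
          \<not> (card {g \<in> carrier G. sym_sum G \<theta> g = 0} = n - 2 \<and>
             (\<exists>g \<in> carrier G. \<not> int n dvd sym_sum G \<theta> g))))"
proof -
  interpret comm_group G by fact
  note fin = assms(2) and n = assms(3)[symmetric]
  have "(\<exists>\<theta>. weight G 1 \<theta>) \<or> (\<exists>\<theta>. near_weight G 1 \<theta> \<and> maximal_partial_weight G 1 \<theta>)"
    using weight_or_near_weight[OF fin] near_weight_maximal[OF fin] by blast
  moreover have
    "\<not> ((\<exists>\<theta>. weight G 1 \<theta>) \<and> (\<exists>\<theta>. near_weight G 1 \<theta> \<and> maximal_partial_weight G 1 \<theta>))"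
    using weight_imp_near_weight_not_maximal[OF fin] by blast
  ultimately show ?thesis
    unfolding n using no_two_coprime_sym_sums[OF fin] no_two_nonzero_sym_sums_prime_order[OF fin]
    by blast
qed

end
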